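(* Let $\mathbf L$ be an infinite set and $1<n\in\mathbb N$. For each hyperfinite $A\in{}^*\mathcal F'({}^*\mathbf L_1\times\cdots\times{}^*\mathbf L_n)$ (where each $\mathbf L_i=\mathbf L$), there exists $C_A\in{}^*\mathcal C_{\mathbf f}$ such that ${}^*\mathbf H_n'(A)=C_A$. Further, for each internal subset $X$ of ${}^*\mathbf L$, $X\vdash_A=C_A(X)$.
   Context: $\mathbf L$ is embedded in a standard superstructure $\mathcal M$ and ${}^*$ denotes a nonstandard extension (enlargement) satisfying transfer, standard objects identified with their ${}^*$-images; internal objects are members of ${}^*B$ for $B$ in $\mathcal M$, and hyperfinite sets are members of ${}^*$ of the set of finite sets. $\mathcal F'(Y)$ denotes the set of nonempty finite subsets of $Y$. $\mathcal C_{\mathbf f}$ is the set of finitary consequence operators on $\mathbf L$: maps $C\colon\mathcal P(\mathbf L)\to\mathcal P(\mathbf L)$ with $X\subseteq C(X)=C(C(X))$ and $C(X)=\bigcup\{C(F):F\text{ a finite subset of }X\}$. $\mathbf T_n'=\mathcal F'(\mathbf L_1\times\cdots\times\mathbf L_n)$, and $\mathbf H_n'\colon\mathbf T_n'\to\mathcal C_{\mathbf f}$ sends $x$ (rules of inference "from $a_1,\dots,a_{n-1}$ deduce $b$" for $(a_1,\dots,a_{n-1},b)\in x$) to the operator $\mathbf H_n'(x)(X)=X\vdash_x$, the set of all members of $\mathbf L$ deducible from $X$ by these rules, i.e. the smallest $Y\supseteq X$ such that $(a_1,\dots,a_{n-1},b)\in x$ and $a_1,\dots,a_{n-1}\in Y$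 imply $b\in Y$. For internal $A$ and $X$, $X\vdash_A$ denotes the value at $(A,X)$ of the ${}^*$-transform of the standard map $(x,X)\mapsto X\vdash_x$. *)

theory Defs
  imports Main
begin

section \<open>Superstructures\<close>

text \<open>
  The cumulative levels over a ground set \<open>X\<close> of individuals with respect to a membership
  relation \<open>R\<close>: \<open>V\<^sub>0 = X\<close> and \<open>V\<^sub>k\<^sub>+\<^sub>1 = V\<^sub>k \<union> \<P>(V\<^sub>k)\<close>.
\<close>

primrec level :: "('a \<Rightarrow> 'a \<Rightarrow> bool) \<Rightarrow> 'a set \<Rightarrow> nat \<Rightarrow> 'a set" where
  "level R X 0 = X"
| "level R X (Suc k) = level R X k \<union> {s. s \<notin> X \<and> {y. R y s} \<subseteq> level R X k}"

text \<open>
  A superstructure \<open>V(X) = \<Union>\<^sub>k V\<^sub>k\<close> over the ground set \<open>X = atoms\<close>, presented as a type.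
  HOL has no type constructor that yields all finite levels at once, so the type is
  characterized (up to isomorphism over \<open>X\<close>) by axioms: individuals have no members, sets are
  extensional, \<^emph>\<open>every\<close> collection of objects of a level is a set of the superstructure, and
  every object has a finite level.
\<close>

class superstructure =
  fixes memb :: "'a \<Rightarrow> 'a \<Rightarrow> bool"  (infix "\<^bold>\<in>" 50)
    and atoms :: "'a set"
  assumes atoms_empty: "x \<in> atoms \<Longrightarrow> \<not> y \<^bold>\<in> x"
    and extensional: "x \<notin> atoms \<Longrightarrow> y \<notin> atoms \<Longrightarrow> (\<And>z. z \<^bold>\<in> x \<longleftrightarrow> z \<^bold>\<in> y) \<Longrightarrow> x = y"
    and full: "S \<subseteq> level (\<^bold>\<in>) atoms k \<Longrightarrow> \<exists>s. s \<notin> atoms \<and> {z. z \<^bold>\<in> s} = S"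
    and exhaustive: "\<exists>k. x \<in> level (\<^bold>\<in>) atoms k"

definition elts :: "'a::superstructure \<Rightarrow> 'a set" where
  "elts s = {y. y \<^bold>\<in> s}"

definition is_set :: "'a::superstructure \<Rightarrow> bool" where
  "is_set s \<longleftrightarrow> s \<notin> atoms"

text \<open>The object whose elements are exactly \<open>S\<close>; it exists iff \<open>S\<close> lies in some level.\<close>

definition coll :: "'a::superstructure set \<Rightarrow> 'a" where
  "coll S = (THE s. is_set s \<and> elts s = S)"

definition pair :: "'a::superstructure \<Rightarrow> 'a \<Rightarrow> 'a" where
  "pair a b = coll {coll {a}, coll {a, b}}"

text \<open>\<open>tuple [a\<^sub>1, \<dots>, a\<^sub>n] = ((\<dots>(a\<^sub>1, a\<^sub>2), \<dots>), a\<^sub>n)\<close>, and \<open>tuple [a] = a\<close>.\<close>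

definition tuple :: "'a::superstructure list \<Rightarrow> 'a" where
  "tuple as = foldl pair (hd as) (tl as)"

definition cart_power :: "nat \<Rightarrow> 'a::superstructure \<Rightarrow> 'a" where
  "cart_power n L = coll {tuple as | as. length as = n \<and> set as \<subseteq> elts L}"

definition powerset :: "'a::superstructure \<Rightarrow> 'a" where
  "powerset s = coll {t. is_set t \<and> elts t \<subseteq> elts s}"

definition fin_subsets :: "'a::superstructure \<Rightarrow> 'a" where
  "fin_subsets s = coll {t. is_set t \<and> elts t \<subseteq> elts s \<and> finite (elts t)}"

definition fin_ne_subsets :: "'a::superstructure \<Rightarrow> 'a" where
  "fin_ne_subsets s = coll {t. is_set t \<and> elts t \<subseteq> elts s \<and> finite (elts t) \<and> elts t \<noteq> {}}"

text \<open>The map \<open>f\<close> with domain \<open>D\<close> as an object of the superstructure (its graph), and the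
  value of such an object at an argument.\<close>

definition graph :: "'a::superstructure \<Rightarrow> ('a \<Rightarrow> 'a) \<Rightarrow> 'a" where
  "graph D f = coll {pair d (f d) | d. d \<^bold>\<in> D}"

definition app :: "'a::superstructure \<Rightarrow> 'a \<Rightarrow> 'a" where
  "app f x = (THE y. pair x y \<^bold>\<in> f)"


section \<open>Nonstandard extensions\<close>

text \<open>Bounded formulas in the language of membership and equality; variables are numbered, and
  \<open>BAll i j \<phi>\<close> is \<open>\<forall>x\<^sub>i \<in> x\<^sub>j. \<phi>\<close>. Parameters enter through the valuation.\<close>

datatype fm = Mem nat nat | Eq nat nat | Neg fm | Conj fm fm | BAll nat nat fm

primrec sat :: "fm \<Rightarrow> (nat \<Rightarrow> 'a::superstructure) \<Rightarrow> bool" where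
  "sat (Mem i j) v \<longleftrightarrow> v i \<^bold>\<in> v j"
| "sat (Eq i j) v \<longleftrightarrow> v i = v j"
| "sat (Neg \<phi>) v \<longleftrightarrow> \<not> sat \<phi> v"
| "sat (Conj \<phi> \<psi>) v \<longleftrightarrow> sat \<phi> v \<and> sat \<psi> v"
| "sat (BAll i j \<phi>) v \<longleftrightarrow> (\<forall>a. a \<^bold>\<in> v j \<longrightarrow> sat \<phi> (v(i := a)))"

text \<open>The last assumption says that the extension is an enlargement: the standard copies of the
  elements of any standard set are all contained in one hyperfinite subset of its extension.\<close>

locale nonstandard_extension =
  fixes star :: "'u::superstructure \<Rightarrow> 'v::superstructure"
  assumes star_ground: "star (coll atoms) = coll atoms"
    and transfer: "sat \<phi> v \<longleftrightarrow> sat \<phi> (\<lambda>i. star (v i))"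
    and enlargement: "is_set D \<Longrightarrow> \<exists>B. B \<^bold>\<in> star (fin_subsets D) \<and> (\<forall>a. a \<^bold>\<in> D \<longrightarrow> star a \<^bold>\<in> B)"

definition internal :: "('u::superstructure \<Rightarrow> 'v::superstructure) \<Rightarrow> 'v \<Rightarrow> bool" where
  "internal star x \<longleftrightarrow> (\<exists>B. is_set B \<and> x \<^bold>\<in> star B)"

definition hyperfinite :: "('u::superstructure \<Rightarrow> 'v::superstructure) \<Rightarrow> 'v \<Rightarrow> bool" where
  "hyperfinite star x \<longleftrightarrow> (\<exists>D. is_set D \<and> x \<^bold>\<in> star (fin_subsets D))"


section \<open>Consequence operators and rules of inference\<close>

definition fin_cons_ops :: "'a::superstructure \<Rightarrow> 'a" where
  "fin_cons_ops L = coll {graph (powerset L) C | C.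
     \<forall>X. X \<^bold>\<in> powerset L \<longrightarrow>
       C X \<^bold>\<in> powerset L \<and> elts X \<subseteq> elts (C X) \<and> C (C X) = C X \<and>
       elts (C X) = \<Union>{elts (C F) | F. is_set F \<and> elts F \<subseteq> elts X \<and> finite (elts F)}}"

definition rule_sets :: "nat \<Rightarrow> 'a::superstructure \<Rightarrow> 'a" where
  "rule_sets n L = fin_ne_subsets (cart_power n L)"

inductive_set deducible :: "nat \<Rightarrow> 'a::superstructure \<Rightarrow> 'a \<Rightarrow> 'a set"
  for n :: nat and x X :: "'a::superstructure" where
  premise: "a \<^bold>\<in> X \<Longrightarrow> a \<in> deducible n x X"
| rule: "length as = n - 1 \<Longrightarrow> tuple (as @ [b]) \<^bold>\<in> x \<Longrightarrow>
    (\<And>a. a \<in> set as \<Longrightarrow> a \<in> deducible n x X) \<Longrightarrow> b \<in> deducible n x X"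

text \<open>\<open>X \<turnstile>\<^sub>x\<close>\<close>

definition ded :: "nat \<Rightarrow> 'a::superstructure \<Rightarrow> 'a \<Rightarrow> 'a" where
  "ded n x X = coll (deducible n x X)"

text \<open>The map \<open>H'\<^sub>n\<close> sending \<open>x\<close> to the operator \<open>X \<mapsto> X \<turnstile>\<^sub>x\<close>, the two-place map
  \<open>(x, X) \<mapsto> X \<turnstile>\<^sub>x\<close>, and the map \<open>F'\<close> on the subsets of \<open>D\<close>, all as objects of the
  superstructure, so that their extensions can be formed.\<close>

definition H_map :: "nat \<Rightarrow> 'a::superstructure \<Rightarrow> 'a" where
  "H_map n L = graph (rule_sets n L) (\<lambda>x. graph (powerset L) (ded n x))"

definition ded_map :: "nat \<Rightarrow> 'a::superstructure \<Rightarrow> 'a" where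
  "ded_map n L = coll {pair (pair x X) (ded n x X) | x X. x \<^bold>\<in> rule_sets n L \<and> X \<^bold>\<in> powerset L}"

definition fin_ne_map :: "'a::superstructure \<Rightarrow> 'a" where
  "fin_ne_map D = graph (powerset D) fin_ne_subsets"

end

(* C_A is the internal operator *H'_n(A). In the standard universe every deducibility operator of a
   finite rule set is a finitary consequence operator, since a deduction uses only finitely many
   premises. So the statements "H'_n is a function from rule sets to finitary consequence operators",
   "every such operator is a function on the power set of L", and "the value of H'_n(x) at X is the
   value of the two-place map at (x, X)" hold there; each is a bounded formula and transfers.
   Internal subsets of *L are exactly the elements of the extended power set. *)

theory Submission
  imports Defs
begin

section \<open>Sets of bounded level\<close>

text \<open>These are the collections that the axiom \<open>full\<close> turns into objects. Outside
  them the description in \<open>coll\<close> has no witness, so every object built by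
  \<open>coll\<close> below comes with a smallness proof.\<close>

definition small :: "'a::superstructure set \<Rightarrow> bool" where
  "small S \<longleftrightarrow> (\<exists>k. S \<subseteq> level (\<^bold>\<in>) atoms k)"

lemma level_mono: "k \<le> m \<Longrightarrow> level R X k \<subseteq> level R X m"
  by (rule lift_Suc_mono_le) auto

text \<open>Individuals have no members, and a set new at some level has its members one level
  below; cumulativity does the rest.\<close>

lemma elts_level: "s \<in> level (\<^bold>\<in>) atoms k \<Longrightarrow> elts (s::'a::superstructure) \<subseteq> level (\<^bold>\<in>) atoms k"
proof (induction k)
  case 0
  then show ?case by (auto simp: elts_def atoms_empty)
qed (auto simp: elts_def)

lemma in_levelI:
  "is_set s \<Longrightarrow> elts s \<subseteq> level (\<^bold>\<in>) atoms k \<Longrightarrow> s \<in> level (\<^bold>\<in>) atoms (Suc k)"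
  by (simp add: elts_def is_set_def)

lemma small_subset: "small T \<Longrightarrow> S \<subseteq> T \<Longrightarrow> small S"
  unfolding small_def by blast

lemma small_elts: "small (elts s)"
  unfolding small_def using exhaustive[of s] elts_level by blast

lemma small_Un: "small S \<Longrightarrow> small T \<Longrightarrow> small (S \<union> T)"
proof -
  assume "small S" "small T"
  then obtain k m where "S \<subseteq> level (\<^bold>\<in>) atoms k" "T \<subseteq> level (\<^bold>\<in>) atoms m"
    unfolding small_def by blast
  then have "S \<union> T \<subseteq> level (\<^bold>\<in>) atoms (max k m)"
    using level_mono[of k "max k m"] level_mono[of m "max k m"]
    by (meson Un_least max.cobounded1 max.cobounded2 subset_trans)
  then show ?thesis unfolding small_def by blast
qed

lemma small_insert: "small S \<Longrightarrow> small (insert a S)"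
  using small_Un[of "{a}" S] exhaustive[of a] unfolding small_def by auto

lemma small_empty: "small {}"
  by (simp add: small_def)

text \<open>All subsets of a level appear one level up. The size bounds for pairs, power sets and
  families of graphs reduce to this.\<close>

lemma small_Pow: "small S \<Longrightarrow> small {t. is_set t \<and> elts t \<subseteq> S}"
proof -
  assume "small S"
  then obtain k where "S \<subseteq> level (\<^bold>\<in>) atoms k" unfolding small_def by blast
  then have "{t. is_set t \<and> elts t \<subseteq> S} \<subseteq> level (\<^bold>\<in>) atoms (Suc k)"
    using in_levelI by blast
  then show ?thesis unfolding small_def by blast
qed

lemma set_eqI_elts: "is_set s \<Longrightarrow> is_set t \<Longrightarrow> elts s = elts t \<Longrightarrow> s = t"
  by (rule extensional) (auto simp: is_set_def elts_def)

lemma is_set_if_memb: "y \<^bold>\<in> s \<Longrightarrow> is_set s"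
  by (auto simp: is_set_def atoms_empty)

lemma coll_elts: "is_set s \<Longrightarrow> coll (elts s) = s"
  unfolding coll_def by (rule the_equality) (auto intro: set_eqI_elts)

lemma
  assumes "small S"
  shows is_set_coll: "is_set (coll S)" and elts_coll: "elts (coll S) = S"
proof -
  obtain s where s: "is_set s" "elts s = S"
    using assms full unfolding small_def is_set_def elts_def by metis
  then have "coll S = s" using coll_elts by blast
  with s show "is_set (coll S)" "elts (coll S) = S" by auto
qed

lemma memb_coll: "small S \<Longrightarrow> y \<^bold>\<in> coll S \<longleftrightarrow> y \<in> S"
  using elts_coll by (auto simp: elts_def)

text \<open>Formulas know only membership and equality; with \<open>coll atoms\<close> as a
  parameter they can express sethood, and \<open>star\<close> maps this parameter to its
  counterpart.\<close>

lemma is_set_iff_not_memb_atoms: "is_set (x::'a::superstructure) \<longleftrightarrow> \<not> x \<^bold>\<in> coll atoms"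
proof -
  have "small (atoms::'a set)" unfolding small_def by (rule exI[of _ 0]) simp
  then show ?thesis by (simp add: memb_coll is_set_def)
qed

lemmas small_intros = small_insert small_empty

section \<open>Kuratowski pairs, products and power sets\<close>

lemma memb_pair: "z \<^bold>\<in> pair a b \<longleftrightarrow> z = coll {a} \<or> z = coll {a, b}"
  unfolding pair_def by (subst memb_coll) (auto intro: small_intros)

lemma coll_inject: "small S \<Longrightarrow> small T \<Longrightarrow> coll S = coll T \<longleftrightarrow> S = T"
  by (metis elts_coll)

lemma pair_inject [simp]: "pair a b = pair c d \<longleftrightarrow> a = c \<and> b = d"
proof
  assume "pair a b = pair c d"
  then have "{coll {a}, coll {a, b}} = {coll {c}, coll {c, d}}"
    unfolding pair_def by (subst (asm) coll_inject) (auto intro: small_intros)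
  then show "a = c \<and> b = d"
    by (auto simp: doubleton_eq_iff coll_inject small_intros)
qed simp

lemma is_set_pair: "is_set (pair a b)"
  unfolding pair_def by (rule is_set_coll) (intro small_intros)

text \<open>The right-hand side is a bounded condition, ready to be written as a formula. That
  \<open>u\<close> is a set follows from its having a member.\<close>

lemma eq_coll_doubleton_iff:
  "u = coll {a, b} \<longleftrightarrow> a \<^bold>\<in> u \<and> b \<^bold>\<in> u \<and> (\<forall>t. t \<^bold>\<in> u \<longrightarrow> t = a \<or> t = b)"
proof
  assume *: "a \<^bold>\<in> u \<and> b \<^bold>\<in> u \<and> (\<forall>t. t \<^bold>\<in> u \<longrightarrow> t = a \<or> t = b)"
  then have "elts u = {a, b}" by (auto simp: elts_def)
  then show "u = coll {a, b}" using coll_elts[of u] is_set_if_memb[of a u] * by simp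
qed (simp add: memb_coll small_intros)

text \<open>A pair is a set of subsets of \<open>S \<union> T\<close>, so two power set steps
  suffice.\<close>

lemma small_pairs:
  assumes "small S" "small T"
  shows "small {pair a b | a b. a \<in> S \<and> b \<in> T}"
proof (rule small_subset)
  show "small {z. is_set z \<and> elts z \<subseteq> {u. is_set u \<and> elts u \<subseteq> S \<union> T}}"
    using assms by (intro small_Pow small_Un)
  show "{pair a b | a b. a \<in> S \<and> b \<in> T} \<subseteq> {z. is_set z \<and> elts z \<subseteq> {u. is_set u \<and> elts u \<subseteq> S \<union> T}}"
    by (auto simp: is_set_pair elts_def[of "pair _ _"] memb_pair is_set_coll elts_coll small_intros)
qed

definition cart :: "'a::superstructure \<Rightarrow> 'a \<Rightarrow> 'a" where
  "cart s t = coll {pair a b | a b. a \<^bold>\<in> s \<and> b \<^bold>\<in> t}"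

lemma small_cart: "small {pair a b | a b. a \<^bold>\<in> s \<and> b \<^bold>\<in> t}"
  using small_pairs[OF small_elts small_elts, of s t] by (simp add: elts_def)

lemma memb_cart: "z \<^bold>\<in> cart s t \<longleftrightarrow> (\<exists>a b. z = pair a b \<and> a \<^bold>\<in> s \<and> b \<^bold>\<in> t)"
  by (simp add: cart_def memb_coll small_cart)

lemma is_set_cart: "is_set (cart s t)"
  by (simp add: cart_def is_set_coll small_cart)

lemma memb_powerset: "t \<^bold>\<in> powerset s \<longleftrightarrow> is_set t \<and> elts t \<subseteq> elts s"
  unfolding powerset_def by (subst memb_coll) (auto intro: small_Pow small_elts)

lemma memb_fin_ne_subsets:
  "t \<^bold>\<in> fin_ne_subsets s \<longleftrightarrow> is_set t \<and> elts t \<subseteq> elts s \<and> finite (elts t) \<and> elts t \<noteq> {}"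
  unfolding fin_ne_subsets_def
  by (subst memb_coll) (auto intro: small_subset[OF small_Pow[OF small_elts[of s]]])

lemma is_set_fin_ne_subsets: "is_set (fin_ne_subsets s)"
  unfolding fin_ne_subsets_def
  by (rule is_set_coll) (auto intro: small_subset[OF small_Pow[OF small_elts[of s]]])

section \<open>Functions as objects\<close>

text \<open>Every quantifier is bounded by \<open>f\<close>, \<open>D\<close> or \<open>E\<close>,
  so that the notion can be transferred; this is why uniqueness is asked only within
  \<open>E\<close>.\<close>

definition is_function :: "'a::superstructure \<Rightarrow> 'a \<Rightarrow> 'a \<Rightarrow> bool" where
  "is_function f D E \<longleftrightarrow>
     (\<forall>p. p \<^bold>\<in> f \<longrightarrow> (\<exists>x. x \<^bold>\<in> D \<and> (\<exists>y. y \<^bold>\<in> E \<and> p = pair x y))) \<and>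
     (\<forall>x. x \<^bold>\<in> D \<longrightarrow> (\<exists>y. y \<^bold>\<in> E \<and> pair x y \<^bold>\<in> f \<and> (\<forall>z. z \<^bold>\<in> E \<longrightarrow> pair x z \<^bold>\<in> f \<longrightarrow> z = y)))"

lemma app_eqI:
  assumes "is_function f D E" "pair x y \<^bold>\<in> f"
  shows "app f x = y"
proof -
  \<comment> \<open>Members of \<open>f\<close> have their second component in \<open>E\<close>, so
    uniqueness within \<open>E\<close> becomes the absolute uniqueness that \<open>app\<close>
    needs.\<close>
  have E: "x \<^bold>\<in> D \<and> z \<^bold>\<in> E" if "pair x z \<^bold>\<in> f" for z
    using assms(1) that unfolding is_function_def by fastforce
  then have "z = y" if "pair x z \<^bold>\<in> f" for z
    using assms that unfolding is_function_def by metis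
  with assms(2) show ?thesis unfolding app_def by blast
qed

lemma app_in:
  assumes "is_function f D E" "x \<^bold>\<in> D"
  shows "app f x \<^bold>\<in> E" "pair x (app f x) \<^bold>\<in> f"
proof -
  obtain y where "y \<^bold>\<in> E" "pair x y \<^bold>\<in> f"
    using assms unfolding is_function_def by blast
  then show "app f x \<^bold>\<in> E" "pair x (app f x) \<^bold>\<in> f"
    using app_eqI[OF assms(1)] by auto
qed

text \<open>The common bound \<open>E\<close> on the values puts the graph inside a product, which
  is small.\<close>

lemma memb_graph:
  assumes "\<And>d. d \<^bold>\<in> D \<Longrightarrow> h d \<^bold>\<in> E"
  shows "p \<^bold>\<in> graph D h \<longleftrightarrow> (\<exists>d. p = pair d (h d) \<and> d \<^bold>\<in> D)"
    and "is_set (graph D h)"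
proof -
  have "small {pair d (h d) | d. d \<^bold>\<in> D}"
    by (rule small_subset[OF small_cart[of D E]]) (use assms in blast)
  then show "p \<^bold>\<in> graph D h \<longleftrightarrow> (\<exists>d. p = pair d (h d) \<and> d \<^bold>\<in> D)" "is_set (graph D h)"
    unfolding graph_def by (simp_all add: memb_coll is_set_coll)
qed

lemma is_function_graph:
  assumes "\<And>d. d \<^bold>\<in> D \<Longrightarrow> h d \<^bold>\<in> E"
  shows "is_function (graph D h) D E"
  unfolding is_function_def using assms by (auto simp: memb_graph[OF assms])

lemma app_graph:
  assumes "\<And>d. d \<^bold>\<in> D \<Longrightarrow> h d \<^bold>\<in> E" "d \<^bold>\<in> D"
  shows "app (graph D h) d = h d"
proof (rule app_eqI)
  show "is_function (graph D h) D E" using assms(1) by (rule is_function_graph)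
  show "pair d (h d) \<^bold>\<in> graph D h" using assms by (auto simp: memb_graph[OF assms(1)])
qed

section \<open>Tuples\<close>

lemma tuple_snoc: "as \<noteq> [] \<Longrightarrow> tuple (as @ [b]) = pair (tuple as) b"
  by (cases as) (simp_all add: tuple_def)

text \<open>Tuples nest to the left, so reverse induction peels off last entries. Lengths must agree
  because an entry may itself be a pair: \<open>tuple [pair a b] = tuple [a, b]\<close>.\<close>

lemma tuple_inject:
  "length as = length bs \<Longrightarrow> as \<noteq> [] \<Longrightarrow> tuple as = tuple bs \<longleftrightarrow> as = bs"
proof (induction as arbitrary: bs rule: rev_induct)
  case (snoc a as)
  then obtain cs c where bs: "bs = cs @ [c]" by (metis length_0_conv rev_exhaust)
  show ?case
  proof (cases "as = []")
    case True
    then show ?thesis using snoc.prems bs by (simp add: tuple_def)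
  next
    case False
    then have "cs \<noteq> []" using snoc.prems bs by auto
    then show ?thesis using snoc False bs by (simp add: tuple_snoc)
  qed
qed simp

lemma cart_power_1: "is_set s \<Longrightarrow> cart_power (Suc 0) s = s"
proof -
  have "{tuple as | as. length as = Suc 0 \<and> set as \<subseteq> elts s} = elts s"
    by (auto simp: length_Suc_conv tuple_def intro: exI[of _ "[_]"])
  then show "is_set s \<Longrightarrow> ?thesis" unfolding cart_power_def by (simp add: coll_elts)
qed

text \<open>Reduces powers to binary products, so that smallness and transfer of powers go by
  induction on the exponent.\<close>

lemma tuples_Suc:
  assumes "0 < n"
  shows "{tuple as | as. length as = Suc n \<and> set as \<subseteq> S} =
    {pair p b | p b. p \<in> {tuple as | as. length as = n \<and> set as \<subseteq> S} \<and> b \<in> S}" (is "?l = ?r")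
proof
  show "?l \<subseteq> ?r"
  proof clarify
    fix as assume as: "length as = Suc n" "set as \<subseteq> S"
    then obtain cs c where cs: "as = cs @ [c]" by (metis length_Suc_conv_rev)
    then have "cs \<noteq> []" using as assms by auto
    then show "\<exists>p b. tuple as = pair p b \<and> p \<in> {tuple as |as. length as = n \<and> set as \<subseteq> S} \<and> b \<in> S"
      using as cs by (auto simp: tuple_snoc)
  qed
  show "?r \<subseteq> ?l"
  proof clarify
    fix as b assume "n = length as" "set as \<subseteq> S" "b \<in> S"
    then show "\<exists>cs. pair (tuple as) b = tuple cs \<and> length cs = Suc (length as) \<and> set cs \<subseteq> S"
      using assms by (intro exI[of _ "as @ [b]"]) (auto simp: tuple_snoc)
  qed
qed

lemma small_tuples: "0 < n \<Longrightarrow> small {tuple as | as. length as = n \<and> set as \<subseteq> elts s}"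
proof (induction n)
  case (Suc n)
  show ?case
  proof (cases "n = 0")
    case True
    have "{tuple as | as. length as = Suc 0 \<and> set as \<subseteq> elts s} \<subseteq> elts s"
      by (auto simp: length_Suc_conv tuple_def)
    then show ?thesis unfolding True by (rule small_subset[OF small_elts])
  next
    case False
    then have n: "0 < n" by simp
    show ?thesis unfolding tuples_Suc[OF n] using Suc.IH[OF n] small_elts by (rule small_pairs)
  qed
qed simp

lemma memb_cart_power:
  "0 < n \<Longrightarrow> z \<^bold>\<in> cart_power n s \<longleftrightarrow> (\<exists>as. z = tuple as \<and> length as = n \<and> set as \<subseteq> elts s)"
  unfolding cart_power_def by (subst memb_coll[OF small_tuples]) auto

lemma cart_power_Suc: "0 < n \<Longrightarrow> cart_power (Suc n) s = cart (cart_power n s) s"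
  unfolding cart_power_def[of "Suc n"] tuples_Suc cart_def
  by (rule arg_cong[of _ _ coll]) (auto simp: memb_cart_power elts_def)

lemma is_set_cart_power: "0 < n \<Longrightarrow> is_set (cart_power n s)"
  unfolding cart_power_def by (intro is_set_coll small_tuples)

section \<open>Deducibility\<close>

text \<open>Quantifying over all \<open>Y\<close> above \<open>F\<close> keeps \<open>F\<close> a
  plain HOL set and yields monotonicity as a by-product.\<close>

lemma deducible_finitary:
  "a \<in> deducible n x X \<Longrightarrow>
    \<exists>F. finite F \<and> F \<subseteq> elts X \<and> (\<forall>Y. F \<subseteq> elts Y \<longrightarrow> a \<in> deducible n x Y)"
proof (induction rule: deducible.induct)
  case (premise a)
  then show ?case
    by (intro exI[of _ "{a}"]) (auto simp: elts_def intro: deducible.premise)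
next
  case (rule as b)
  let ?P = "\<lambda>a F. finite F \<and> F \<subseteq> elts X \<and> (\<forall>Y. F \<subseteq> elts Y \<longrightarrow> a \<in> deducible n x Y)"
  \<comment> \<open>Each premise of the rule has its own finite support; the union over the finite
    list \<open>as\<close> supports \<open>b\<close>.\<close>
  have "\<forall>a\<in>set as. \<exists>F. ?P a F" using rule.IH by blast
  then have "\<exists>F. \<forall>a\<in>set as. ?P a (F a)" by (rule bchoice)
  then obtain F where F: "\<forall>a\<in>set as. ?P a (F a)" by (rule exE)
  have "b \<in> deducible n x Y" if "(\<Union>a\<in>set as. F a) \<subseteq> elts Y" for Y
  proof (rule deducible.rule[OF rule.hyps(1,2)])
    fix a assume a: "a \<in> set as"
    then have "F a \<subseteq> elts Y" using that by blast
    then show "a \<in> deducible n x Y" using F a by blast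
  qed
  moreover have "finite (\<Union>a\<in>set as. F a)" using F by simp
  moreover have "(\<Union>a\<in>set as. F a) \<subseteq> elts X" using F by blast
  ultimately show ?case by blast
qed

lemma deducible_mono: "elts X \<subseteq> elts Y \<Longrightarrow> deducible n x X \<subseteq> deducible n x Y"
  using deducible_finitary by blast

lemma deducible_idem:
  assumes "elts Y = deducible n x X"
  shows "deducible n x Y = deducible n x X"
proof
  show "deducible n x Y \<subseteq> deducible n x X"
  proof
    fix a assume "a \<in> deducible n x Y"
    then show "a \<in> deducible n x X"
      by induction (use assms in \<open>auto simp: elts_def intro: deducible.rule\<close>)
  qed
  show "deducible n x X \<subseteq> deducible n x Y"
    using assms by (auto simp: elts_def intro: deducible.premise)
qed

text \<open>The conclusion of a rule is the last entry of a tuple over \<open>L\<close>, so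
  deduction never leaves \<open>L\<close>. Hence the deducible set is small and \<open>ded\<close>
  denotes it.\<close>

lemma deducible_subset:
  assumes "elts x \<subseteq> elts (cart_power n L)" "elts X \<subseteq> elts L" "0 < n"
  shows "deducible n x X \<subseteq> elts L"
proof
  fix a assume "a \<in> deducible n x X"
  then show "a \<in> elts L"
  proof induction
    case (rule as b)
    then have "tuple (as @ [b]) \<^bold>\<in> cart_power n L" using assms(1) by (auto simp: elts_def)
    then obtain cs where "tuple (as @ [b]) = tuple cs" "length cs = n" "set cs \<subseteq> elts L"
      using memb_cart_power assms(3) by blast
    \<comment> \<open>Since \<open>0 < n\<close>, the list \<open>as @ [b]\<close> has length
      \<open>n\<close> and must equal \<open>cs\<close>.\<close>
    then show ?case using tuple_inject[of "as @ [b]" cs] rule.hyps assms(3) by auto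
  qed (use assms(2) in \<open>auto simp: elts_def\<close>)
qed

lemma ded_in_powerset:
  assumes "x \<^bold>\<in> rule_sets n L" "X \<^bold>\<in> powerset L" "0 < n"
  shows "elts (ded n x X) = deducible n x X" "ded n x X \<^bold>\<in> powerset L"
proof -
  have sub: "deducible n x X \<subseteq> elts L"
    using assms by (intro deducible_subset) (auto simp: rule_sets_def memb_fin_ne_subsets memb_powerset)
  then have "small (deducible n x X)" using small_elts small_subset by blast
  then show "elts (ded n x X) = deducible n x X" "ded n x X \<^bold>\<in> powerset L"
    using sub by (auto simp: ded_def memb_powerset elts_coll is_set_coll)
qed

section \<open>Finitary consequence operators as objects\<close>

lemma fin_cons_ops_small:
  "small {graph (powerset L) C | C. \<forall>X. X \<^bold>\<in> powerset L \<longrightarrow>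
       C X \<^bold>\<in> powerset L \<and> elts X \<subseteq> elts (C X) \<and> C (C X) = C X \<and>
       elts (C X) = \<Union>{elts (C F) | F. is_set F \<and> elts F \<subseteq> elts X \<and> finite (elts F)}}"
proof (rule small_subset[OF small_Pow[OF small_cart[of "powerset L" "powerset L"]]], clarify)
  fix C assume "\<forall>X. X \<^bold>\<in> powerset L \<longrightarrow>
       C X \<^bold>\<in> powerset L \<and> elts X \<subseteq> elts (C X) \<and> C (C X) = C X \<and>
       elts (C X) = \<Union>{elts (C F) | F. is_set F \<and> elts F \<subseteq> elts X \<and> finite (elts F)}"
  then have *: "C X \<^bold>\<in> powerset L" if "X \<^bold>\<in> powerset L" for X using that by blast
  show "is_set (graph (powerset L) C) \<and>
      elts (graph (powerset L) C) \<subseteq> {pair a b |a b. a \<^bold>\<in> powerset L \<and> b \<^bold>\<in> powerset L}"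
    using * by (auto simp: elts_def[of "graph _ _"] memb_graph[OF *])
qed

lemma is_function_fin_cons_op:
  assumes "f \<^bold>\<in> fin_cons_ops L"
  shows "is_function f (powerset L) (powerset L)"
proof -
  obtain C where "f = graph (powerset L) C" "\<forall>X. X \<^bold>\<in> powerset L \<longrightarrow> C X \<^bold>\<in> powerset L"
    using assms unfolding fin_cons_ops_def memb_coll[OF fin_cons_ops_small] by blast
  then show ?thesis using is_function_graph by metis
qed

lemma ded_fin_cons_op:
  assumes x: "x \<^bold>\<in> rule_sets n L" and n: "0 < n"
  shows "graph (powerset L) (ded n x) \<^bold>\<in> fin_cons_ops L"
  unfolding fin_cons_ops_def memb_coll[OF fin_cons_ops_small]
proof (intro CollectI exI conjI allI impI)
  fix X assume X: "X \<^bold>\<in> powerset L"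
  note ded = ded_in_powerset[OF x _ n]
  show P: "ded n x X \<^bold>\<in> powerset L" using ded X by blast
  show "elts X \<subseteq> elts (ded n x X)"
    using X by (auto simp: ded elts_def[of X] intro: deducible.premise)
  show "ded n x (ded n x X) = ded n x X"
    unfolding ded_def[of n x "ded n x X"] using ded(1)[OF X] by (simp add: deducible_idem ded_def)
  show "elts (ded n x X) = \<Union>{elts (ded n x F) | F. is_set F \<and> elts F \<subseteq> elts X \<and> finite (elts F)}"
  proof (intro equalityI subsetI)
    fix a assume "a \<in> elts (ded n x X)"
    then have "a \<in> deducible n x X" using ded(1)[OF X] by simp
    from deducible_finitary[OF this] obtain F
      where F: "finite F" "F \<subseteq> elts X" "\<forall>Y. F \<subseteq> elts Y \<longrightarrow> a \<in> deducible n x Y" by (elim exE conjE)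
    \<comment> \<open>The finitary clause speaks of objects; \<open>F\<close> becomes one because it
      is part of \<open>elts X\<close>.\<close>
    have "small F" using F(2) small_elts small_subset by blast
    note cF = elts_coll[OF this] is_set_coll[OF this]
    then have "coll F \<^bold>\<in> powerset L" using F(2) X by (auto simp: memb_powerset)
    then have "elts (ded n x (coll F)) = deducible n x (coll F)" by (rule ded(1))
    then have "a \<in> elts (ded n x (coll F))" using F(3) cF(1) by simp
    moreover have "elts (coll F) \<subseteq> elts X" "finite (elts (coll F))" using F(1,2) cF(1) by simp_all
    ultimately show "a \<in> \<Union>{elts (ded n x F) | F. is_set F \<and> elts F \<subseteq> elts X \<and> finite (elts F)}"
      using cF(2) by blast
  next
    fix a assume "a \<in> \<Union>{elts (ded n x F) | F. is_set F \<and> elts F \<subseteq> elts X \<and> finite (elts F)}"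
    then obtain F where F: "a \<in> elts (ded n x F)" "is_set F" "elts F \<subseteq> elts X" by blast
    then have "F \<^bold>\<in> powerset L" using X by (auto simp: memb_powerset)
    then show "a \<in> elts (ded n x X)"
      using F(1) deducible_mono[OF F(3)] unfolding ded(1)[OF X] by (auto simp: ded(1))
  qed
qed simp

section \<open>The deducibility maps as functions\<close>

lemma is_function_H_map: "0 < n \<Longrightarrow> is_function (H_map n L) (rule_sets n L) (fin_cons_ops L)"
  unfolding H_map_def by (intro is_function_graph ded_fin_cons_op)

text \<open>The two descriptions recover the components of a pair, so the two-place map is an
  ordinary graph over a product and the facts on graphs apply.\<close>

lemma ded_map_eq_graph:
  "ded_map n L = graph (cart (rule_sets n L) (powerset L))
     (\<lambda>p. ded n (THE x. \<exists>X. p = pair x X) (THE X. \<exists>x. p = pair x X))"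
  unfolding ded_map_def graph_def by (rule arg_cong[of _ _ coll]) (force simp: memb_cart)

lemma
  assumes "0 < n"
  shows is_function_ded_map:
      "is_function (ded_map n L) (cart (rule_sets n L) (powerset L)) (powerset L)"
    and memb_ded_map: "x \<^bold>\<in> rule_sets n L \<Longrightarrow> X \<^bold>\<in> powerset L \<Longrightarrow>
      pair (pair x X) (ded n x X) \<^bold>\<in> ded_map n L"
proof -
  let ?h = "\<lambda>p. ded n (THE x. \<exists>X. p = pair x X) (THE X. \<exists>x. p = pair x X)"
  have *: "?h p \<^bold>\<in> powerset L" if "p \<^bold>\<in> cart (rule_sets n L) (powerset L)" for p
    using that assms by (auto simp: memb_cart ded_in_powerset)
  show "is_function (ded_map n L) (cart (rule_sets n L) (powerset L)) (powerset L)"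
    unfolding ded_map_eq_graph using * by (rule is_function_graph)
  show "pair (pair x X) (ded n x X) \<^bold>\<in> ded_map n L"
    if "x \<^bold>\<in> rule_sets n L" "X \<^bold>\<in> powerset L"
    unfolding ded_map_eq_graph using that
    by (subst memb_graph(1)[OF *]) (auto simp: memb_cart)
qed

section \<open>Bounded formulas\<close>

definition Ex_fm :: "nat \<Rightarrow> nat \<Rightarrow> fm \<Rightarrow> fm" where
  "Ex_fm i j \<phi> = Neg (BAll i j (Neg \<phi>))"

definition Imp_fm :: "fm \<Rightarrow> fm \<Rightarrow> fm" where
  "Imp_fm \<phi> \<psi> = Neg (Conj \<phi> (Neg \<psi>))"

lemma sat_Ex_fm [simp]: "sat (Ex_fm i j \<phi>) v \<longleftrightarrow> (\<exists>a. a \<^bold>\<in> v j \<and> sat \<phi> (v(i := a)))"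
  by (simp add: Ex_fm_def)

lemma sat_Imp_fm [simp]: "sat (Imp_fm \<phi> \<psi>) v \<longleftrightarrow> (sat \<phi> v \<longrightarrow> sat \<psi> v)"
  by (simp add: Imp_fm_def)

text \<open>In the formulas below \<open>m\<close> bounds the variables in use: bound variables are taken from \<open>m\<close>
  upwards.\<close>

definition Upair_fm :: "nat \<Rightarrow> nat \<Rightarrow> nat \<Rightarrow> nat \<Rightarrow> fm" where
  "Upair_fm m u i j = Conj (Mem i u) (Conj (Mem j u)
     (BAll m u (Imp_fm (Neg (Eq m i)) (Eq m j))))"

text \<open>Both Kuratowski components are members of \<open>z\<close>, so quantifiers bounded by
  \<open>z\<close> find them.\<close>

definition Pair_fm :: "nat \<Rightarrow> nat \<Rightarrow> nat \<Rightarrow> nat \<Rightarrow> fm" where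
  "Pair_fm m z i j = Ex_fm m z (Ex_fm (m + 1) z (Conj (Upair_fm (m + 2) m i i)
     (Conj (Upair_fm (m + 2) (m + 1) i j) (Upair_fm (m + 2) z m (m + 1)))))"

definition Pair_in_fm :: "nat \<Rightarrow> nat \<Rightarrow> nat \<Rightarrow> nat \<Rightarrow> fm" where
  "Pair_in_fm m i j f = Ex_fm m f (Pair_fm (m + 1) m i j)"

definition Function_fm :: "nat \<Rightarrow> nat \<Rightarrow> nat \<Rightarrow> nat \<Rightarrow> fm" where
  "Function_fm m f d e = Conj
     (BAll m f (Ex_fm (m + 1) d (Ex_fm (m + 2) e (Pair_fm (m + 3) m (m + 1) (m + 2)))))
     (BAll m d (Ex_fm (m + 1) e (Conj (Pair_in_fm (m + 2) m (m + 1) f)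
       (BAll (m + 2) e (Imp_fm (Pair_in_fm (m + 3) m (m + 2) f) (Eq (m + 2) (m + 1)))))))"

text \<open>The strict bounds keep the bound variable \<open>m\<close> from overwriting a parameter;
  the same holds for the formulas that follow.\<close>

lemma sat_Upair_fm [simp]:
  "u < m \<Longrightarrow> i < m \<Longrightarrow> j < m \<Longrightarrow> sat (Upair_fm m u i j) v \<longleftrightarrow> v u = coll {v i, v j}"
  unfolding eq_coll_doubleton_iff by (auto simp: Upair_fm_def)

lemma sat_Pair_fm [simp]:
  "z < m \<Longrightarrow> i < m \<Longrightarrow> j < m \<Longrightarrow> sat (Pair_fm m z i j) v \<longleftrightarrow> v z = pair (v i) (v j)"
  by (auto simp: Pair_fm_def pair_def memb_coll small_intros)

lemma sat_Pair_in_fm [simp]: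
  "i < m \<Longrightarrow> j < m \<Longrightarrow> f < m \<Longrightarrow> sat (Pair_in_fm m i j f) v \<longleftrightarrow> pair (v i) (v j) \<^bold>\<in> v f"
  by (auto simp: Pair_in_fm_def)

lemma sat_Function_fm [simp]:
  "f < m \<Longrightarrow> d < m \<Longrightarrow> e < m \<Longrightarrow> sat (Function_fm m f d e) v \<longleftrightarrow> is_function (v f) (v d) (v e)"
  by (simp add: Function_fm_def is_function_def)

section \<open>Transfer\<close>

context nonstandard_extension
begin

text \<open>In this and the later valuations the default value is the object meant for variable 0;
  the updates supply the other parameters.\<close>

lemma star_memb: "star x \<^bold>\<in> star y \<longleftrightarrow> x \<^bold>\<in> y"
  using transfer[of "Mem 0 1" "(\<lambda>_. x)(1 := y)"] by simp

lemma is_set_star: "is_set (star x) \<longleftrightarrow> is_set x"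
  using star_memb[of x "coll atoms"] by (simp add: is_set_iff_not_memb_atoms star_ground)

lemma star_pair: "star (pair x y) = pair (star x) (star y)"
  using transfer[of "Pair_fm 3 0 1 2" "(\<lambda>_. pair x y)(1 := x, 2 := y)"] by simp

lemma star_is_function:
  "is_function f D E \<Longrightarrow> is_function (star f) (star D) (star E)"
  using transfer[of "Function_fm 3 0 1 2" "(\<lambda>_. f)(1 := D, 2 := E)"] by simp

text \<open>An element of \<open>star F\<close> need not be the image of an element of
  \<open>F\<close>, so the quantifier over \<open>F\<close> has to be inside the transferred
  formula.\<close>

lemma star_is_function_ball:
  assumes "\<And>f. f \<^bold>\<in> F \<Longrightarrow> is_function f D E" "g \<^bold>\<in> star F"
  shows "is_function g (star D) (star E)"
  using transfer[of "BAll 3 0 (Function_fm 4 3 1 2)" "(\<lambda>_. F)(1 := D, 2 := E)"] assms by simp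

lemma star_app:
  assumes "is_function f D E" "x \<^bold>\<in> D"
  shows "app (star f) (star x) = star (app f x)"
  using app_eqI[OF star_is_function[OF assms(1)]] app_in(2)[OF assms] star_memb star_pair by metis

text \<open>The two inclusions are separate bounded statements about \<open>s\<close>,
  \<open>t\<close> and their product, each transferred on its own.\<close>

lemma star_cart: "star (cart s t) = cart (star s) (star t)"
proof (rule set_eqI_elts)
  let ?v = "(\<lambda>_. cart s t)(1 := s, 2 := t)"
  have "\<forall>p. p \<^bold>\<in> star (cart s t) \<longrightarrow> (\<exists>a. a \<^bold>\<in> star s \<and> (\<exists>b. b \<^bold>\<in> star t \<and> p = pair a b))"
    using transfer[of "BAll 3 0 (Ex_fm 4 1 (Ex_fm 5 2 (Pair_fm 6 3 4 5)))" ?v]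
    by (auto simp: memb_cart)
  moreover have "\<forall>a. a \<^bold>\<in> star s \<longrightarrow> (\<forall>b. b \<^bold>\<in> star t \<longrightarrow> pair a b \<^bold>\<in> star (cart s t))"
    using transfer[of "BAll 3 1 (BAll 4 2 (Pair_in_fm 5 3 4 0))" ?v] by (auto simp: memb_cart)
  ultimately show "elts (star (cart s t)) = elts (cart (star s) (star t))"
    by (auto simp: elts_def memb_cart)
qed (simp_all add: is_set_star is_set_cart)

text \<open>The exponent is a natural number of the metatheory, so ordinary induction applies; the
  true base case is exponent 1.\<close>

lemma star_cart_power:
  assumes "is_set s" "0 < n"
  shows "star (cart_power n s) = cart_power n (star s)"
  using assms(2)
proof (induction n)
  case (Suc n)
  then show ?case
    by (cases "n = 0") (simp_all add: cart_power_1 is_set_star assms(1) cart_power_Suc star_cart)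
qed simp

text \<open>Internality provides a standard \<open>B\<close> with \<open>X\<close> in
  \<open>star B\<close>. That members of \<open>B\<close> which are subsets of \<open>s\<close> lie
  in \<open>powerset s\<close> is then a statement bounded by \<open>B\<close>.\<close>

lemma internal_subset_in_star_powerset:
  assumes "internal star X" "is_set X" "elts X \<subseteq> elts (star s)"
  shows "X \<^bold>\<in> star (powerset s)"
proof -
  obtain B where B: "X \<^bold>\<in> star B" using assms(1) unfolding internal_def by blast
  let ?\<phi> = "BAll 4 0 (Imp_fm (Neg (Mem 4 1)) (Imp_fm (BAll 5 4 (Mem 5 2)) (Mem 4 3)))"
  let ?v = "(\<lambda>_. B)(1 := coll atoms, 2 := s, 3 := powerset s)"
  have "sat ?\<phi> ?v" by (auto simp: memb_powerset is_set_iff_not_memb_atoms elts_def)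
  then have "sat ?\<phi> (\<lambda>i. star (?v i))" using transfer by blast
  then show ?thesis using B assms(2,3) by (auto simp: star_ground is_set_iff_not_memb_atoms elts_def)
qed

end

section \<open>The internal consequence operator of a hyperfinite rule set\<close>

theorem theorem3p1:
  fixes star :: "'u::superstructure \<Rightarrow> 'v::superstructure"
    and L :: 'u and n :: nat and A :: 'v
  assumes "nonstandard_extension star"
    and "is_set L" and "infinite (elts L)"
    and "1 < n"
    and "hyperfinite star A"
    and "A \<^bold>\<in> app (star (fin_ne_map (cart_power n L))) (cart_power n (star L))"
  shows "\<exists>C\<^sub>A. C\<^sub>A \<^bold>\<in> star (fin_cons_ops L) \<and>
           app (star (H_map n L)) A = C\<^sub>A \<and>
           (\<forall>X. internal star X \<and> is_set X \<and> elts X \<subseteq> elts (star L) \<longrightarrow>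
              app (star (ded_map n L)) (pair A X) = app C\<^sub>A X)"
proof -
  interpret nonstandard_extension star by fact
  have n: "0 < n" using assms(4) by simp
  let ?D = "cart_power n L" and ?P = "powerset L" and ?R = "rule_sets n L" and ?F = "fin_cons_ops L"
  \<comment> \<open>This codomain for the map F' on the subsets of \<open>?D\<close> makes its graph
    a function object.\<close>
  have fne: "fin_ne_subsets d \<^bold>\<in> powerset (powerset ?D)" if "d \<^bold>\<in> powerset ?D" for d
    using that is_set_fin_ne_subsets
    by (auto simp: memb_powerset elts_def[of "fin_ne_subsets d"] elts_def[of "powerset ?D"]
        memb_fin_ne_subsets)
  have D: "?D \<^bold>\<in> powerset ?D" using is_set_cart_power[OF n] by (simp add: memb_powerset)
  \<comment> \<open>\<open>star ?D\<close> is the \<open>n\<close>-fold power of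
    \<open>star L\<close>, so this value is the set assumed to contain \<open>A\<close>, now seen to
    be the extension of the set of rule sets.\<close>
  have "app (star (fin_ne_map ?D)) (star ?D) = star (fin_ne_subsets ?D)"
    unfolding fin_ne_map_def
    using star_app[OF is_function_graph[OF fne] D] app_graph[OF fne D] by simp
  then have A: "A \<^bold>\<in> star ?R"
    using assms(6) by (simp add: star_cart_power[OF assms(2) n] rule_sets_def)

  note funs = star_is_function[OF is_function_H_map[OF n, of L]]
    star_is_function[OF is_function_ded_map[OF n, of L]]
  let ?C = "app (star (H_map n L)) A"
  have C: "?C \<^bold>\<in> star ?F" "pair A ?C \<^bold>\<in> star (H_map n L)"
    using app_in[OF funs(1) A] by auto

  \<comment> \<open>Agreement of the two maps at \<open>(x, X)\<close>, written without
    \<open>app\<close>: both relate to the same value \<open>Y\<close> (variable 13). Variable 14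
    ranges over the product, giving the pair \<open>(x, X)\<close> a bounded quantifier. Starting at
    20 keeps the inner bound variables clear of all these.\<close>
  let ?\<phi> = "BAll 10 0 (BAll 11 1 (Ex_fm 12 2 (Ex_fm 13 1 (Ex_fm 14 5 (
     Conj (Pair_fm 20 14 10 11) (Conj (Pair_in_fm 20 10 12 3)
     (Conj (Pair_in_fm 20 14 13 4) (Pair_in_fm 20 11 13 12))))))))"
  let ?v = "(\<lambda>_. ?R)(1 := ?P, 2 := ?F, 3 := H_map n L, 4 := ded_map n L, 5 := cart ?R ?P)"
  have *: "\<exists>C. C \<^bold>\<in> ?F \<and> (\<exists>Y. Y \<^bold>\<in> ?P \<and> (\<exists>q. q \<^bold>\<in> cart ?R ?P \<and> q = pair x X \<and>
      pair x C \<^bold>\<in> H_map n L \<and> pair q Y \<^bold>\<in> ded_map n L \<and> pair X Y \<^bold>\<in> C))"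
    if x: "x \<^bold>\<in> ?R" and X: "X \<^bold>\<in> ?P" for x X
  proof (intro exI conjI)
    let ?c = "graph ?P (ded n x)"
    show "?c \<^bold>\<in> ?F" using x n by (rule ded_fin_cons_op)
    show "ded n x X \<^bold>\<in> ?P" using ded_in_powerset x X n by blast
    show "pair x X \<^bold>\<in> cart ?R ?P" using x X by (auto simp: memb_cart)
    show "pair x ?c \<^bold>\<in> H_map n L"
      unfolding H_map_def using x by (subst memb_graph(1)[OF ded_fin_cons_op[OF _ n]]) auto
    show "pair (pair x X) (ded n x X) \<^bold>\<in> ded_map n L" using memb_ded_map n x X by blast
    show "pair X (ded n x X) \<^bold>\<in> ?c"
      using X by (subst memb_graph(1)[OF ded_in_powerset(2)[OF x _ n]]) auto
  qed simp
  have "sat ?\<phi> ?v" using * by simp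
  then have "sat ?\<phi> (\<lambda>i. star (?v i))" using transfer by blast
  then have transferred: "\<exists>C. C \<^bold>\<in> star ?F \<and> (\<exists>Y. pair A C \<^bold>\<in> star (H_map n L) \<and>
      pair (pair A X) Y \<^bold>\<in> star (ded_map n L) \<and> pair X Y \<^bold>\<in> C)"
    if "X \<^bold>\<in> star ?P" for X
    using A that by simp blast

  have "app (star (ded_map n L)) (pair A X) = app ?C X" if "X \<^bold>\<in> star ?P" for X
  proof -
    obtain C Y where CY: "C \<^bold>\<in> star ?F" "pair A C \<^bold>\<in> star (H_map n L)"
      "pair (pair A X) Y \<^bold>\<in> star (ded_map n L)" "pair X Y \<^bold>\<in> C"
      using transferred[OF \<open>X \<^bold>\<in> star ?P\<close>] by blast
    \<comment> \<open>Transfer supplies some operator \<open>C\<close>; single-valuedness of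
      \<open>star (H_map n L)\<close> identifies it with \<open>?C\<close>.\<close>
    have "?C = C" using app_eqI[OF funs(1) CY(2)] .
    \<comment> \<open>\<open>C\<close> is known only as an element of \<open>star ?F\<close>, so
      that it is a function comes from the transferred statement about all members of
      \<open>?F\<close>.\<close>
    moreover have "app C X = Y"
      using app_eqI[OF star_is_function_ball[OF is_function_fin_cons_op CY(1)] CY(4)] .
    ultimately show ?thesis using app_eqI[OF funs(2) CY(3)] by simp
  qed
  then show ?thesis using C(1) internal_subset_in_star_powerset by blast
qed

end
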